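(* Let $\mathcal{A}:\mathbf{S}^n\to\mathbb{R}^m$ be a surjective linear map and $b\in\mathbb{R}^m$, and suppose the primal Slater's condition holds: there is some $X_0\in\mathbf{S}^n$ with $X_0\succ0$ and $\mathcal{A}(X_0)=b$. Then for almost all $C\in\mathbf{S}^n$, the semidefinite program $$\text{minimize }\langle C,X\rangle\quad\text{subject to}\quad \mathcal{A}X=b,\ X\succeq0,\qquad X\in\mathbf{S}^n,$$ is primal simple as long as it has a (primal optimal) solution.
   Context: $\mathbf{S}^n$ is the space of real symmetric $n\times n$ matrices with the trace inner product $\langle X,Y\rangle=\operatorname{tr}(X^\top Y)$; "almost all" is with respect to Lebesgue measure on $\mathbf{S}^n$. Consider a standard form SDP (P): minimize $\langle C,X\rangle$ subject to $\mathcal{A}X=b$, $X\succeq0$, with variable $X\in\mathbf{S}^n$, where $[\mathcal{A}X]_i=\langle A_i,X\rangle$ for $i=1,\dots,m$ with fixed $A_i\in\mathbf{S}^n$. Its dual (D) is: maximize $\langle b,y\rangle$ subject to $C-\mathcal{A}^*y\succeq0$, with variable $y\in\mathbb{R}^m$, where $\mathcal{A}^*y=\sum_i y_iA_i$. "Solution" means optimal solution. - Strong duality: a primal-dual solution pair exists, and for any solution pair $(X_\star,y_\star)$ of (P) and (D), $\operatorname{tr}(CX_\star)=b^\top y_\star$. - Surjective constraint map: $\mathcal{A}$ is surjective, equivalently the matrices $A_i$ are linearly independent. - Strict complementarity: there is a solution pair $(X_\star,y_\star)$ of (P) and (D) with $\operatorname{rank}(X_\star)+\operatorname{rank}(C-\mathcal{A}^*y_\star)=n$.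 - (P) is primal simple if it has a surjective constraint map, satisfies strong duality and strict complementarity, and the solution to (P) is unique (the dual solution need not be unique). *)

theory Defs
  imports "HOL-Analysis.Analysis"
begin

section \<open>The Euclidean space of real symmetric matrices\<close>

text \<open>
  The space of real symmetric matrices is a type of its own, so that the library's
  Lebesgue measure, adjoints, etc. on an arbitrary Euclidean space apply to it directly.
\<close>

typedef 'n symmat = "{X :: real^'n^'n. transpose X = X}"
  morphisms mat_of symmat_of
  by (rule exI[of _ 0]) (simp add: transpose_def vec_eq_iff)

setup_lifting type_definition_symmat

lemma transpose_mat_of [simp]: "transpose (mat_of X) = mat_of X"
  using mat_of[of X] by (simp only: mem_Collect_eq)

lemma mat_of_sym: "mat_of X $ i $ j = mat_of X $ j $ i"
proof -
  have "transpose (mat_of X) $ i $ j = mat_of X $ j $ i"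
    by (simp only: transpose_def vec_lambda_beta)
  then show ?thesis by (simp only: transpose_mat_of)
qed

lemma trace_transpose_mult:
  fixes X Y :: "real^'n^'n"
  shows "trace (transpose X ** Y) = X \<bullet> Y"
proof -
  have "trace (transpose X ** Y) = (\<Sum>i\<in>UNIV. \<Sum>k\<in>UNIV. X $ k $ i * Y $ k $ i)"
    by (simp only: trace_def transpose_def matrix_matrix_mult_def vec_lambda_beta)
  also have "\<dots> = (\<Sum>k\<in>UNIV. \<Sum>i\<in>UNIV. X $ k $ i * Y $ k $ i)"
    by (rule sum.swap)
  also have "\<dots> = X \<bullet> Y"
    by (simp only: inner_vec_def inner_real_def)
  finally show ?thesis .
qed

instantiation symmat :: (finite) real_vector
begin

lift_definition zero_symmat :: "'a symmat" is 0
  by (simp add: transpose_def vec_eq_iff)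
lift_definition plus_symmat :: "'a symmat \<Rightarrow> 'a symmat \<Rightarrow> 'a symmat" is "(+)"
  by (simp add: transpose_def vec_eq_iff)
lift_definition minus_symmat :: "'a symmat \<Rightarrow> 'a symmat \<Rightarrow> 'a symmat" is "(-)"
  by (simp add: transpose_def vec_eq_iff)
lift_definition uminus_symmat :: "'a symmat \<Rightarrow> 'a symmat" is uminus
  by (simp add: transpose_def vec_eq_iff)
lift_definition scaleR_symmat :: "real \<Rightarrow> 'a symmat \<Rightarrow> 'a symmat" is scaleR
  by (simp add: transpose_def vec_eq_iff)

instance
  by standard (transfer, simp add: add.assoc scaleR_add_left scaleR_add_right; fail | transfer, rule add.commute)+

end

instantiation symmat :: (finite) real_inner
begin

definition inner_symmat :: "'a symmat \<Rightarrow> 'a symmat \<Rightarrow> real" where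
  "inner_symmat X Y = trace (transpose (mat_of X) ** mat_of Y)"

definition norm_symmat :: "'a symmat \<Rightarrow> real" where
  "norm_symmat X = sqrt (X \<bullet> X)"

definition sgn_symmat :: "'a symmat \<Rightarrow> 'a symmat" where
  "sgn_symmat X = inverse (norm X) *\<^sub>R X"

definition dist_symmat :: "'a symmat \<Rightarrow> 'a symmat \<Rightarrow> real" where
  "dist_symmat X Y = norm (X - Y)"

definition uniformity_symmat :: "('a symmat \<times> 'a symmat) filter" where
  "uniformity_symmat = (INF e\<in>{0<..}. principal {(X, Y). dist X Y < e})"

definition open_symmat :: "'a symmat set \<Rightarrow> bool" where
  "open_symmat U \<longleftrightarrow> (\<forall>X\<in>U. \<forall>\<^sub>F (X', Y) in uniformity. X' = X \<longrightarrow> Y \<in> U)"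

instance
proof
  fix X Y Z :: "'a symmat" and r :: real
  show "X \<bullet> Y = Y \<bullet> X"
    unfolding inner_symmat_def trace_transpose_mult by (rule inner_commute)
  show "(X + Y) \<bullet> Z = X \<bullet> Z + Y \<bullet> Z"
    unfolding inner_symmat_def trace_transpose_mult plus_symmat.rep_eq by (rule inner_add_left)
  show "(r *\<^sub>R X) \<bullet> Y = r * (X \<bullet> Y)"
    unfolding inner_symmat_def trace_transpose_mult scaleR_symmat.rep_eq by (rule inner_scaleR_left)
  show "0 \<le> X \<bullet> X"
    unfolding inner_symmat_def trace_transpose_mult by (rule inner_ge_zero)
  show "X \<bullet> X = 0 \<longleftrightarrow> X = 0"
    unfolding inner_symmat_def trace_transpose_mult
    by (metis inner_eq_zero_iff mat_of_inject zero_symmat.rep_eq)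
qed (fact norm_symmat_def sgn_symmat_def dist_symmat_def uniformity_symmat_def open_symmat_def)+

end

lemma inner_symmat_eq: "X \<bullet> Y = mat_of X \<bullet> mat_of Y"
  by (simp only: inner_symmat_def trace_transpose_mult)

text \<open>
  The orthonormal basis: \<open>E\<^sub>i\<^sub>i\<close> on the diagonal and \<open>(E\<^sub>i\<^sub>j + E\<^sub>j\<^sub>i) / \<surd>2\<close> off the diagonal.
  It is indexed by ordered pairs, but \<open>(i, j)\<close> and \<open>(j, i)\<close> give the same element.
\<close>

lift_definition symmat_unit :: "'n::finite \<Rightarrow> 'n \<Rightarrow> 'n symmat" is
  "\<lambda>i j. if i = j then axis i (axis i 1)
         else (1 / sqrt 2) *\<^sub>R (axis i (axis j 1) + axis j (axis i 1)) :: real^'n^'n"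
  by (auto simp: transpose_def vec_eq_iff axis_def)

lemma inner_symmat_unit:
  "X \<bullet> symmat_unit i j = (if i = j then 1 else sqrt 2) * mat_of X $ i $ j"
proof (cases "i = j")
  case True
  then show ?thesis
    by (simp add: inner_symmat_eq symmat_unit.rep_eq inner_axis)
next
  case False
  have "X \<bullet> symmat_unit i j = (1 / sqrt 2) * (mat_of X $ i $ j + mat_of X $ j $ i)"
    using False by (simp add: inner_symmat_eq symmat_unit.rep_eq inner_axis inner_add_right add_divide_distrib)
  also have "\<dots> = (2 / sqrt 2) * mat_of X $ i $ j"
    by (simp add: mat_of_sym[of X j i])
  finally show ?thesis using False by (simp add: real_div_sqrt)
qed

lemma symmat_unit_commute: "symmat_unit i j = symmat_unit j i"
  by transfer (auto simp: add.commute)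

lemma symmat_unit_inner_symmat_unit:
  "symmat_unit i j \<bullet> symmat_unit k l = (if {i, j} = {k, l} then 1 else 0)"
  unfolding inner_symmat_unit
  by (auto simp: symmat_unit.rep_eq axis_def doubleton_eq_iff)

instantiation symmat :: (finite) euclidean_space
begin

definition Basis_symmat :: "'a symmat set" where
  "Basis_symmat = range (\<lambda>(i, j). symmat_unit i j)"

instance
proof
  show "(Basis :: 'a symmat set) \<noteq> {}" "finite (Basis :: 'a symmat set)"
    by (auto simp: Basis_symmat_def)
next
  fix u v :: "'a symmat"
  assume "u \<in> Basis" "v \<in> Basis"
  then obtain i j k l where uv: "u = symmat_unit i j" "v = symmat_unit k l"
    by (auto simp: Basis_symmat_def)
  have "u = v \<longleftrightarrow> {i, j} = {k, l}"
  proof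
    assume "u = v"
    then have "symmat_unit i j \<bullet> symmat_unit k l = symmat_unit i j \<bullet> symmat_unit i j"
      using uv by simp
    then show "{i, j} = {k, l}"
      by (simp add: symmat_unit_inner_symmat_unit split: if_splits)
  next
    assume "{i, j} = {k, l}"
    then show "u = v"
      using uv symmat_unit_commute[of i j] by (auto simp only: doubleton_eq_iff)
  qed
  then show "u \<bullet> v = (if u = v then 1 else 0)"
    using uv by (simp add: symmat_unit_inner_symmat_unit)
next
  fix X :: "'a symmat"
  show "(\<forall>u\<in>Basis. X \<bullet> u = 0) \<longleftrightarrow> X = 0"
  proof
    assume "\<forall>u\<in>Basis. X \<bullet> u = 0"
    then have "X \<bullet> symmat_unit i j = 0" for i j
      by (auto simp: Basis_symmat_def)
    then have "mat_of X $ i $ j = 0" for i j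
      using inner_symmat_unit[of X i j] by (simp split: if_splits)
    then have "mat_of X = mat_of 0"
      by (simp add: vec_eq_iff zero_symmat.rep_eq)
    then show "X = 0"
      by (simp only: mat_of_inject)
  qed simp
qed

end

section \<open>Semidefinite programs in standard form\<close>

definition psd :: "'n::finite symmat \<Rightarrow> bool" where
  "psd X \<longleftrightarrow> (\<forall>v. 0 \<le> v \<bullet> (mat_of X *v v))"

definition pos_def :: "'n::finite symmat \<Rightarrow> bool" where
  "pos_def X \<longleftrightarrow> (\<forall>v. v \<noteq> 0 \<longrightarrow> 0 < v \<bullet> (mat_of X *v v))"

definition primal_feasible :: "('n::finite symmat \<Rightarrow> real^'m) \<Rightarrow> real^'m \<Rightarrow> 'n symmat \<Rightarrow> bool" where
  "primal_feasible A b X \<longleftrightarrow> A X = b \<and> psd X"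

definition primal_solution ::
    "('n::finite symmat \<Rightarrow> real^'m) \<Rightarrow> real^'m \<Rightarrow> 'n symmat \<Rightarrow> 'n symmat \<Rightarrow> bool" where
  "primal_solution A b C X \<longleftrightarrow>
     primal_feasible A b X \<and> (\<forall>X'. primal_feasible A b X' \<longrightarrow> C \<bullet> X \<le> C \<bullet> X')"

definition dual_feasible :: "('n::finite symmat \<Rightarrow> real^'m) \<Rightarrow> 'n symmat \<Rightarrow> real^'m \<Rightarrow> bool" where
  "dual_feasible A C y \<longleftrightarrow> psd (C - adjoint A y)"

definition dual_solution ::
    "('n::finite symmat \<Rightarrow> real^'m) \<Rightarrow> real^'m \<Rightarrow> 'n symmat \<Rightarrow> real^'m \<Rightarrow> bool" where
  "dual_solution A b C y \<longleftrightarrow>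
     dual_feasible A C y \<and> (\<forall>y'. dual_feasible A C y' \<longrightarrow> b \<bullet> y' \<le> b \<bullet> y)"

text \<open>
  For a constraint map given by matrices \<open>A\<^sub>i\<close>, the library's adjoint is \<open>y \<mapsto> \<Sum>\<^sub>i y\<^sub>i A\<^sub>i\<close>.
\<close>

lemma adjoint_constraint_map:
  fixes Ai :: "'m::finite \<Rightarrow> 'n::finite symmat"
  shows "adjoint (\<lambda>X. (\<chi> i. Ai i \<bullet> X) :: real^'m) = (\<lambda>y. \<Sum>i\<in>UNIV. (y $ i) *\<^sub>R Ai i)"
  by (rule adjoint_unique) (simp add: inner_vec_def inner_sum_right inner_commute mult.commute)

definition strong_duality ::
    "('n::finite symmat \<Rightarrow> real^'m) \<Rightarrow> real^'m \<Rightarrow> 'n symmat \<Rightarrow> bool" where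
  "strong_duality A b C \<longleftrightarrow>
     (\<exists>X y. primal_solution A b C X \<and> dual_solution A b C y) \<and>
     (\<forall>X y. primal_solution A b C X \<and> dual_solution A b C y \<longrightarrow>
        trace (mat_of C ** mat_of X) = b \<bullet> y)"

definition strict_complementarity ::
    "('n::finite symmat \<Rightarrow> real^'m) \<Rightarrow> real^'m \<Rightarrow> 'n symmat \<Rightarrow> bool" where
  "strict_complementarity A b C \<longleftrightarrow>
     (\<exists>X y. primal_solution A b C X \<and> dual_solution A b C y \<and>
        rank (mat_of X) + rank (mat_of (C - adjoint A y)) = CARD('n))"

definition primal_simple ::
    "('n::finite symmat \<Rightarrow> real^'m) \<Rightarrow> real^'m \<Rightarrow> 'n symmat \<Rightarrow> bool" where
  "primal_simple A b C \<longleftrightarrow>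
     surj A \<and> strong_duality A b C \<and> strict_complementarity A b C \<and>
     (\<exists>!X. primal_solution A b C X)"

end

theory Submission
  imports Defs
begin

text \<open>
  Two sets of objectives \<open>C\<close> have to be shown negligible: those with several primal solutions,
  and those with a solution but without strict complementarity. Both proofs produce uncountably
  many pairwise disjoint measurable sets, one of which must then be negligible
  (\<open>negligible_member_of_disjoint_family\<close>), and both rest on the monotonicity of the
  solution relation: if \<open>X\<close>, \<open>X'\<close> solve the problem for \<open>C\<close>, \<open>C'\<close>, then
  \<open>\<langle>X - X', C - C'\<rangle> \<le> 0\<close>.

  Uniqueness. If \<open>C\<close> has two solutions, some basis vector \<open>e\<close> and rationals \<open>q < q'\<close> satisfy
  \<open>\<langle>X, e\<rangle> \<le> q < q' \<le> \<langle>X', e\<rangle>\<close>. For fixed \<open>e\<close>, \<open>q\<close>, \<open>q'\<close>, monotonicity allows at most one such \<open>C\<close>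
  on each line of direction \<open>e\<close>, so the translates of this set along \<open>e\<close> are disjoint.

  Strict complementarity. By Slater's condition, \<open>X\<close> is optimal for \<open>C\<close> iff it is feasible and some
  slack \<open>S = C - \<A>\<^sup>*y \<succeq> 0\<close> has \<open>\<langle>S, X\<rangle> = 0\<close> (\<open>complementary_dual_exists\<close>,
  \<open>complementary_imp_solutions\<close>). Let \<open>E\<close> be the orthogonal projection onto the kernel of \<open>X\<close>. Such an
  \<open>S\<close> is strictly complementary as soon as \<open>S - d E \<succeq> 0\<close> for some \<open>d > 0\<close>. Hence if \<open>(X, C)\<close> is an
  optimal pair for which no \<open>S\<close> is strictly complementary, then for every \<open>t > 0\<close> the pair
  \<open>(X, C + t E)\<close> is optimal and does have a strictly complementary \<open>S\<close>. By monotonicity the map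
  \<open>(X, C) \<mapsto> X - C\<close> is injective on optimal pairs, with 1-Lipschitz inverse. So the images of the bad
  pairs under \<open>(X, C) \<mapsto> X - (C + t E)\<close> are disjoint for different \<open>t\<close>: a common point of two of them
  would come from bad pairs \<open>(X, C)\<close> and \<open>(X, C + s E)\<close> with \<open>s > 0\<close>. Hence one image is negligible.
  On the pairs where \<open>E\<close> and the pseudoinverse of \<open>X\<close> are bounded by a constant \<open>r\<close>, \<open>E\<close> is a
  Lipschitz function of \<open>X\<close> (\<open>kernel_split_Lipschitz\<close>), so \<open>C\<close> is a Lipschitz function of
  \<open>X - (C + t E)\<close> and the bad objectives form a negligible set as well
  (\<open>negligible_monotone_shift\<close>). Countably many \<open>r\<close> exhaust all cases.
\<close>

section \<open>Uncountable disjoint families and shifts along a monotone relation\<close>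

lemma negligible_member_of_disjoint_family:
  fixes S :: "real \<Rightarrow> 'a::euclidean_space set"
  assumes meas: "\<And>t. t > 0 \<Longrightarrow> S t \<in> sets lebesgue"
    and disj: "\<And>s t. \<lbrakk>0 < s; s < t\<rbrakk> \<Longrightarrow> S s \<inter> S t = {}"
  shows "\<exists>t>0. negligible (S t)"
proof (rule ccontr)
  assume "\<not> (\<exists>t>0. negligible (S t))"
  then have nonneg: "\<not> negligible (S t)" if "t > 0" for t
    using that by blast
  \<comment> \<open>For each bound on the size and each lower bound on the measure, only finitely many indices occur.\<close>
  define P where "P n k = {t. 0 < t \<and> 1 / real (Suc k) < measure lebesgue (S t \<inter> cball 0 (real n))}" for n k
  have fin: "S t \<inter> cball 0 (real n) \<in> lmeasurable" if "t > 0" for t n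
    using fmeasurable_Int_fmeasurable[OF lmeasurable_cball meas[OF that]] by (simp add: Int_commute)
  have "{0<..} \<subseteq> (\<Union>n k. P n k)"
  proof
    fix t :: real
    assume "t \<in> {0<..}"
    then have t: "t > 0" by simp
    have "S t = (\<Union>n. S t \<inter> cball 0 (real n))"
      by (auto simp: real_arch_simple)
    then obtain n where "\<not> negligible (S t \<inter> cball 0 (real n))"
      using nonneg[OF t] negligible_countable_Union[of "range (\<lambda>n. S t \<inter> cball 0 (real n))"]
      by auto
    then have "0 < measure lebesgue (S t \<inter> cball 0 (real n))"
      using fin[OF t, of n] by (simp add: negligible_iff_measure zero_less_measure_iff measure_le_0_iff)
    then obtain k where "1 / real (Suc k) < measure lebesgue (S t \<inter> cball 0 (real n))"
      using nat_approx_posE by blast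
    then show "t \<in> (\<Union>n k. P n k)"
      using t by (auto simp: P_def)
  qed
  moreover have "finite (P n k)" for n k
  proof (rule ccontr)
    let ?m = "measure lebesgue (cball (0::'a) (real n))"
    assume "infinite (P n k)"
    then obtain T where T: "finite T" "T \<subseteq> P n k" "card T = nat \<lceil>?m * real (Suc k)\<rceil> + 1"
      using infinite_arbitrarily_large by blast
    have Tpos: "t > 0" if "t \<in> T" for t
      using T(2) that by (auto simp: P_def)
    have "(\<Sum>t\<in>T. 1 / real (Suc k)) \<le> (\<Sum>t\<in>T. measure lebesgue (S t \<inter> cball 0 (real n)))"
      using T(2) by (intro sum_mono) (auto simp: P_def intro: less_imp_le)
    also have "\<dots> = measure lebesgue (\<Union>t\<in>T. S t \<inter> cball 0 (real n))"
    proof (rule measure_finite_Union[symmetric])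
      show "disjoint_family_on (\<lambda>t. S t \<inter> cball 0 (real n)) T"
        unfolding disjoint_family_on_def
      proof (intro ballI impI)
        fix s t assume "s \<in> T" "t \<in> T" "s \<noteq> t"
        then have "S s \<inter> S t = {}"
          using T(2) disj[of s t] disj[of t s] unfolding P_def by (cases "s < t") auto
        then show "S s \<inter> cball 0 (real n) \<inter> (S t \<inter> cball 0 (real n)) = {}"
          by blast
      qed
    next
      fix t assume "t \<in> T"
      then show "emeasure lebesgue (S t \<inter> cball 0 (real n)) \<noteq> \<infinity>"
        using fmeasurableD2[OF fin[OF Tpos]] by simp
    qed (use T(1) fmeasurableD[OF fin[OF Tpos]] in auto)
    also have "\<dots> \<le> ?m"
      using T(1) fmeasurableD[OF fin[OF Tpos]]
      by (intro measure_mono_fmeasurable sets.finite_UN) auto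
    finally have "real (card T) \<le> ?m * real (Suc k)"
      by (simp add: field_simps)
    with T(3) show False
      by linarith
  qed
  ultimately have "countable {0::real<..}"
    by (meson countable_UN countable_finite countable_subset countableI_type)
  then show False
    using uncountable_open_interval[of 0 "1::real"] countable_subset[of "{0<..<1::real}" "{0<..}"]
    by force
qed

text \<open>A compact set that meets every line of direction \<open>e\<close> at most once is negligible.\<close>

lemma negligible_disjoint_translates:
  fixes D :: "'a::euclidean_space set"
  assumes "compact D" and disj: "\<And>c t. \<lbrakk>c \<in> D; t > 0\<rbrakk> \<Longrightarrow> c + t *\<^sub>R e \<notin> D"
  shows "negligible D"
proof -
  have "\<exists>t>0. negligible ((+) (t *\<^sub>R e) ` D)"
  proof (rule negligible_member_of_disjoint_family)
    fix t :: real
    show "(+) (t *\<^sub>R e) ` D \<in> sets lebesgue"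
      using compact_translation[OF assms(1)] by (simp add: lmeasurable_compact fmeasurableD)
  next
    fix s t :: real
    assume st: "s < t"
    show "(+) (s *\<^sub>R e) ` D \<inter> (+) (t *\<^sub>R e) ` D = {}"
    proof (rule ccontr)
      assume "\<not> ?thesis"
      then obtain c c' where c: "c \<in> D" "c' \<in> D" "s *\<^sub>R e + c = t *\<^sub>R e + c'"
        by auto
      then have "c = c' + (t - s) *\<^sub>R e"
        by (simp add: algebra_simps)
      with c st disj[of c' "t - s"] show False
        by simp
    qed
  qed
  then show ?thesis
    using negligible_translation_rev by blast
qed

lemma norm_diff_of_monotone:
  fixes a b :: "'a::real_inner"
  assumes "a \<bullet> b \<le> 0"
  shows "norm a \<le> norm (a - b)" "norm b \<le> norm (a - b)"
proof -
  have "(norm (a - b))\<^sup>2 = (norm a)\<^sup>2 + (norm b)\<^sup>2 - 2 * (a \<bullet> b)"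
    by (simp add: power2_norm_eq_inner inner_diff_left inner_diff_right inner_commute)
  then have "(norm a)\<^sup>2 \<le> (norm (a - b))\<^sup>2" "(norm b)\<^sup>2 \<le> (norm (a - b))\<^sup>2"
    using assms zero_le_power2[of "norm a"] zero_le_power2[of "norm b"] by linarith+
  then show "norm a \<le> norm (a - b)" "norm b \<le> norm (a - b)"
    by (auto intro: power2_le_imp_le)
qed

text \<open>
  The pairs \<open>(x, c)\<close> with attached direction \<open>e\<close> form a monotone relation (with \<open>c\<close> negated) that
  stays monotone when \<open>c\<close> is moved forward along \<open>e\<close>, whereas any positive move leads out of the
  subset \<open>R\<close>. Then the values \<open>c\<close> occurring in \<open>R\<close> form a negligible set. The special shape of \<open>R\<close> only
  serves the measurability of its images: injective maps commute with the set difference, and the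
  images of \<open>K\<close> and \<open>J j\<close> are compact.
\<close>

lemma negligible_monotone_shift:
  fixes K R :: "('a::euclidean_space \<times> 'a \<times> 'a) set" and J :: "nat \<Rightarrow> ('a \<times> 'a \<times> 'a) set"
  assumes K: "compact K" and J: "\<And>j. compact (J j)" "\<And>j. J j \<subseteq> K" and R: "R = K - (\<Union>j. J j)"
    and mono: "\<And>x c e x' c' e' s t. \<lbrakk>(x, c, e) \<in> K; (x', c', e') \<in> K; 0 \<le> s; 0 \<le> t\<rbrakk>
                 \<Longrightarrow> (x - x') \<bullet> ((c + s *\<^sub>R e) - (c' + t *\<^sub>R e')) \<le> 0"
    and lip: "\<And>x c e x' c' e'. \<lbrakk>(x, c, e) \<in> K; (x', c', e') \<in> K\<rbrakk>
                 \<Longrightarrow> norm (e - e') \<le> L * norm (x - x')"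
    and shift: "\<And>x c e t. \<lbrakk>(x, c, e) \<in> R; t > 0\<rbrakk> \<Longrightarrow> (x, c + t *\<^sub>R e, e) \<notin> R"
  shows "negligible ((\<lambda>(x, c, e). c) ` R)"
proof -
  define w :: "real \<Rightarrow> 'a \<times> 'a \<times> 'a \<Rightarrow> 'a" where "w t = (\<lambda>(x, c, e). x - (c + t *\<^sub>R e))" for t
  have RK: "R \<subseteq> K" by (auto simp: R)
  have dist1: "norm (x - x') \<le> norm (w s (x, c, e) - w t (x', c', e'))"
    and dist2: "norm ((c + s *\<^sub>R e) - (c' + t *\<^sub>R e')) \<le> norm (w s (x, c, e) - w t (x', c', e'))"
    if "(x, c, e) \<in> K" "(x', c', e') \<in> K" "0 \<le> s" "0 \<le> t" for x c e x' c' e' s t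
  proof -
    have *: "w s (x, c, e) - w t (x', c', e') = (x - x') - ((c + s *\<^sub>R e) - (c' + t *\<^sub>R e'))"
      by (simp add: w_def)
    show "norm (x - x') \<le> norm (w s (x, c, e) - w t (x', c', e'))"
      "norm ((c + s *\<^sub>R e) - (c' + t *\<^sub>R e')) \<le> norm (w s (x, c, e) - w t (x', c', e'))"
      unfolding * using norm_diff_of_monotone[OF mono[OF that]] by auto
  qed
  have eq: "x = x' \<and> e = e' \<and> c + s *\<^sub>R e = c' + t *\<^sub>R e'"
    if "(x, c, e) \<in> K" "(x', c', e') \<in> K" "0 \<le> s" "0 \<le> t" "w s (x, c, e) = w t (x', c', e')"
    for x c e x' c' e' s t
    using dist1[OF that(1-4)] dist2[OF that(1-4)] that(5) lip[OF that(1,2)] by auto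
  have inj: "inj_on (w t) K" if "t > 0" for t
    unfolding inj_on_def
  proof (intro ballI impI)
    fix p p' assume "p \<in> K" "p' \<in> K" "w t p = w t p'"
    then show "p = p'"
      using eq[of "fst p" "fst (snd p)" "snd (snd p)" "fst p'" "fst (snd p')" "snd (snd p')" t t] that
      by (auto simp: prod_eq_iff)
  qed
  have comp: "compact (w t ` T)" if "compact T" for t T
    using that unfolding w_def case_prod_beta
    by (intro compact_continuous_image continuous_intros) auto
  have "\<exists>t>0. negligible (w t ` R)"
  proof (rule negligible_member_of_disjoint_family)
    fix t :: real
    assume "t > 0"
    have "w t ` R = w t ` K - (\<Union>j. w t ` J j)"
      unfolding R using J(2) inj_on_image_set_diff[OF inj[OF \<open>t > 0\<close>], of K "\<Union>j. J j"]
      by (auto simp: image_UN)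
    then show "w t ` R \<in> sets lebesgue"
      using comp[OF K] comp[OF J(1)]
      by (auto intro!: sets.Diff sets.countable_UN simp: fmeasurableD lmeasurable_compact)
  next
    fix s t :: real
    assume st: "0 < s" "s < t"
    show "w s ` R \<inter> w t ` R = {}"
    proof (rule ccontr)
      assume "\<not> ?thesis"
      then obtain x c e x' c' e' where p: "(x, c, e) \<in> R" "(x', c', e') \<in> R"
        "w s (x, c, e) = w t (x', c', e')"
        by (smt (verit) disjoint_iff imageE prod_cases3)
      then have "x = x'" "e = e'" "c + s *\<^sub>R e = c' + t *\<^sub>R e'"
        using eq[of x c e x' c' e' s t] RK st by auto
      then have "(x', c' + (t - s) *\<^sub>R e', e') = (x, c, e)"
        by (simp add: algebra_simps)
      with p shift[of x' c' e' "t - s"] st show False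
        by simp
    qed
  qed
  then obtain t where t: "t > 0" "negligible (w t ` R)"
    by blast
  \<comment> \<open>The component \<open>c\<close> is a Lipschitz function of \<open>x - (c + t *\<^sub>R e)\<close>.\<close>
  define f where "f = (\<lambda>z. case inv_into R (w t) z of (x, c, e) \<Rightarrow> c)"
  have injR: "inj_on (w t) R"
    using inj[OF t(1)] RK by (rule inj_on_subset)
  have fw: "f (w t (x, c, e)) = c" if "(x, c, e) \<in> R" for x c e
    using that by (simp add: f_def inv_into_f_f[OF injR])
  have lipf: "norm (f z - f z') \<le> (1 + t * \<bar>L\<bar>) * norm (z - z')" if zR: "z \<in> w t ` R" "z' \<in> w t ` R" for z z'
  proof -
    obtain p p' where "p \<in> R" "p' \<in> R" "z = w t p" "z' = w t p'"
      using zR by blast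
    then obtain x c e x' c' e' where p: "(x, c, e) \<in> R" "(x', c', e') \<in> R"
      and z: "z = w t (x, c, e)" "z' = w t (x', c', e')"
      by (cases p, cases p') auto
    then have pK: "(x, c, e) \<in> K" "(x', c', e') \<in> K" using RK by auto
    have "c - c' = ((c + t *\<^sub>R e) - (c' + t *\<^sub>R e')) - t *\<^sub>R (e - e')"
      by (simp add: algebra_simps)
    then have "norm (c - c') \<le> norm ((c + t *\<^sub>R e) - (c' + t *\<^sub>R e')) + t * norm (e - e')"
      using t(1) norm_triangle_ineq4[of "(c + t *\<^sub>R e) - (c' + t *\<^sub>R e')" "t *\<^sub>R (e - e')"]
      by (metis abs_of_pos norm_scaleR)
    also have "\<dots> \<le> norm (z - z') + t * (\<bar>L\<bar> * norm (z - z'))"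
    proof (rule add_mono)
      show "norm ((c + t *\<^sub>R e) - (c' + t *\<^sub>R e')) \<le> norm (z - z')"
        using dist2[OF pK, of t t] t(1) z by simp
      have "norm (e - e') \<le> L * norm (x - x')"
        by (rule lip[OF pK])
      also have "\<dots> \<le> \<bar>L\<bar> * norm (z - z')"
        using dist1[OF pK, of t t] t(1) z by (intro mult_mono) auto
      finally show "t * norm (e - e') \<le> t * (\<bar>L\<bar> * norm (z - z'))"
        using t(1) by simp
    qed
    finally show ?thesis
      using fw p z by (simp add: algebra_simps)
  qed
  have "negligible (f ` (w t ` R))"
  proof (rule negligible_locally_Lipschitz_image[OF _ t(2)])
    fix z assume "z \<in> w t ` R"
    then show "\<exists>T B. open T \<and> z \<in> T \<and> (\<forall>y\<in>w t ` R \<inter> T. norm (f y - f z) \<le> B * norm (y - z))"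
      using lipf by (intro exI[of _ UNIV] exI[of _ "1 + t * \<bar>L\<bar>"]) auto
  qed simp
  moreover have "f ` (w t ` R) = (\<lambda>(x, c, e). c) ` R"
    using fw by (force simp: image_image intro!: image_cong)
  ultimately show ?thesis
    by simp
qed

section \<open>Positive semidefinite matrices\<close>

lemma linear_mat_of: "linear mat_of"
  by (rule linearI) (simp_all add: plus_symmat.rep_eq scaleR_symmat.rep_eq)

lemma mat_of_diff: "mat_of (X - Y) = mat_of X - mat_of Y"
  by (rule linear_diff[OF linear_mat_of])

lemma mat_of_sum_mult: "mat_of (\<Sum>i\<in>I. f i) *v v = (\<Sum>i\<in>I. mat_of (f i) *v v)"
proof -
  have "linear (\<lambda>X. mat_of X *v v)"
    by (rule linearI) (simp_all add: plus_symmat.rep_eq scaleR_symmat.rep_eq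
        matrix_vector_mult_add_rdistrib scaleR_matrix_vector_assoc)
  then show ?thesis
    by (rule linear_sum)
qed

lemma inner_mat_of_swap: "u \<bullet> (mat_of X *v v) = v \<bullet> (mat_of X *v u)"
  by (metis dot_lmul_matrix inner_commute transpose_mat_of transpose_matrix_vector)

lemma inner_eq_trace: "C \<bullet> X = trace (mat_of C ** mat_of X)"
  by (simp add: inner_symmat_def)

lemma norm_mat_of: "norm (mat_of X) = norm X"
  by (simp add: norm_eq_sqrt_inner inner_symmat_eq)

text \<open>The matrix \<open>v v\<^sup>T\<close>.\<close>

lift_definition outer :: "real^'n \<Rightarrow> 'n::finite symmat" is "\<lambda>v. \<chi> i j. v $ i * v $ j"
  by (simp add: transpose_def vec_eq_iff mult.commute)

lemma outer_mult: "mat_of (outer v) *v u = (v \<bullet> u) *\<^sub>R v"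
  by (simp add: outer.rep_eq vec_eq_iff matrix_vector_mult_def inner_vec_def sum_distrib_left mult_ac)

lemma inner_outer: "X \<bullet> outer v = v \<bullet> (mat_of X *v v)"
  by (simp add: inner_symmat_eq outer.rep_eq inner_vec_def matrix_vector_mult_def
      sum_distrib_left sum_distrib_right mult_ac)

lemma outer_0 [simp]: "outer 0 = 0"
  by transfer (simp add: vec_eq_iff)

lemma psd_iff_outer: "psd X \<longleftrightarrow> (\<forall>v. 0 \<le> X \<bullet> outer v)"
  by (simp add: psd_def inner_outer)

lemma psd_outer: "psd (outer v)"
  by (simp add: psd_def outer_mult inner_commute)

lemma psd_0 [simp]: "psd 0"
  by (simp add: psd_iff_outer)

lemma psd_add: "psd X \<Longrightarrow> psd Y \<Longrightarrow> psd (X + Y)"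
  by (simp add: psd_iff_outer inner_add_left)

lemma psd_scaleR: "psd X \<Longrightarrow> 0 \<le> c \<Longrightarrow> psd (c *\<^sub>R X)"
  by (simp add: psd_iff_outer)

lemma closed_psd: "closed {X. psd X}"
  unfolding psd_iff_outer Collect_all_eq
  by (intro closed_INT ballI closed_Collect_le continuous_intros)

lemma pos_def_imp_psd: "pos_def X \<Longrightarrow> psd X"
  unfolding pos_def_def psd_def by (metis inner_zero_left less_eq_real_def)

lemma psd_null_vector:
  assumes "psd X" "v \<bullet> (mat_of X *v v) = 0"
  shows "mat_of X *v v = 0"
proof (rule ccontr)
  define u where "u = mat_of X *v v"
  define a where "a = u \<bullet> (mat_of X *v u)"
  assume "mat_of X *v v \<noteq> 0"
  then have "0 < u \<bullet> u" by (simp add: u_def)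
  have *: "0 \<le> s\<^sup>2 * a - 2 * s * (u \<bullet> u)" for s
  proof -
    have "0 \<le> (s *\<^sub>R u - v) \<bullet> (mat_of X *v (s *\<^sub>R u - v))"
      using assms(1) by (simp add: psd_def)
    also have "\<dots> = s\<^sup>2 * a - 2 * s * (u \<bullet> u)"
      using assms(2) inner_mat_of_swap[of u X v]
      by (simp add: matrix_vector_mult_diff_distrib matrix_vector_mult_scaleR inner_diff_left
          inner_diff_right a_def u_def power2_eq_square algebra_simps)
    finally show ?thesis .
  qed
  have "0 \<le> a"
    using assms(1) by (simp add: psd_def a_def)
  \<comment> \<open>Small enough for the linear term to dominate; the \<open>+ 1\<close> covers \<open>a = 0\<close>.\<close>
  define s where "s = (u \<bullet> u) / (a + 1)"
  have s: "s > 0" "s * a \<le> u \<bullet> u"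
    using \<open>0 < u \<bullet> u\<close> \<open>0 \<le> a\<close> by (auto simp: s_def field_simps)
  have "s * (s * a - 2 * (u \<bullet> u)) \<ge> 0"
    using *[of s] by (simp add: power2_eq_square algebra_simps)
  then show False
    using s \<open>0 < u \<bullet> u\<close> by (simp add: zero_le_mult_iff)
qed

text \<open>
  Subtracting \<open>u u\<^sup>T / c\<close>, where \<open>u\<close> is the \<open>k\<close>-th column and \<open>c\<close> the \<open>k\<close>-th diagonal entry, keeps the
  matrix positive semidefinite and clears its \<open>k\<close>-th row and column, as in the Cholesky
  decomposition. When \<open>c = 0\<close>, the column is already zero; the convention \<open>1 / 0 = 0\<close> then makes the
  subtracted matrix zero.
\<close>

lemma psd_sum_outer_aux:
  fixes X :: "'n::finite symmat"
  assumes "finite I" "psd X" "\<And>i. i \<notin> I \<Longrightarrow> mat_of X $ i $ i = 0"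
  shows "\<exists>f. X = (\<Sum>i\<in>I. outer (f i))"
  using assms
proof (induction I arbitrary: X rule: finite_induct)
  case empty
  have "mat_of X *v axis i 1 = 0" for i
    using empty by (intro psd_null_vector) (auto simp: inner_axis' matrix_vector_mult_basis column_def)
  then have "mat_of X = 0"
    by (simp add: matrix_vector_mult_basis column_def vec_eq_iff)
  then have "X = 0"
    by (metis mat_of_inject zero_symmat.rep_eq)
  then show ?case by simp
next
  case (insert k I)
  define c where "c = mat_of X $ k $ k"
  define u where "u = mat_of X *v axis k 1"
  have ui: "u $ i = mat_of X $ i $ k" for i
    by (simp add: u_def matrix_vector_mult_basis column_def)
  have "0 \<le> axis k 1 \<bullet> (mat_of X *v axis k 1)"
    using insert.prems(1) by (simp add: psd_def)
  then have "0 \<le> c"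
    by (simp add: c_def inner_axis' matrix_vector_mult_basis column_def)
  define Y where "Y = X - outer ((1 / sqrt c) *\<^sub>R u)"
  have Yij: "mat_of Y $ i $ j = mat_of X $ i $ j - u $ i * u $ j / c" for i j
    using \<open>0 \<le> c\<close> by (simp add: Y_def mat_of_diff outer.rep_eq)
  have "psd Y"
    unfolding psd_def
  proof
    fix v
    show "0 \<le> v \<bullet> (mat_of Y *v v)"
    proof (cases "c = 0")
      case True
      then show ?thesis using insert.prems(1) by (simp add: Y_def psd_def)
    next
      case False
      \<comment> \<open>This multiple of the \<open>k\<close>-th unit vector minimizes the quadratic form along its direction.\<close>
      define s where "s = (u \<bullet> v) / c"
      have "0 \<le> (v - s *\<^sub>R axis k 1) \<bullet> (mat_of X *v (v - s *\<^sub>R axis k 1))"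
        using insert.prems(1) by (simp add: psd_def)
      also have "\<dots> = v \<bullet> (mat_of X *v v) - 2 * s * (u \<bullet> v) + s\<^sup>2 * c"
        using inner_mat_of_swap[of "axis k 1" X v] ui[of k]
        by (simp add: inner_axis matrix_vector_mult_diff_distrib matrix_vector_mult_scaleR inner_diff_left
            inner_diff_right u_def[symmetric] inner_axis' ui c_def[symmetric] power2_eq_square
            algebra_simps inner_commute)
      also have "\<dots> = v \<bullet> (mat_of X *v v) - (u \<bullet> v)\<^sup>2 / c"
        using False by (simp add: s_def power2_eq_square field_simps)
      also have "\<dots> = v \<bullet> (mat_of Y *v v)"
        using \<open>0 \<le> c\<close> by (simp add: Y_def mat_of_diff matrix_vector_mult_diff_rdistrib outer_mult inner_diff_right
            power2_eq_square inner_commute)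
      finally show ?thesis .
    qed
  qed
  moreover have "mat_of Y $ i $ i = 0" if "i \<notin> I" for i
  proof (cases "i = k")
    case True
    then show ?thesis by (simp add: Yij ui c_def)
  next
    case False
    then have "mat_of X $ i $ i = 0"
      using insert.prems(2) that by simp
    then have "mat_of X *v axis i 1 = 0"
      using insert.prems(1)
      by (intro psd_null_vector) (auto simp: inner_axis' matrix_vector_mult_basis column_def)
    then have "mat_of X $ k $ i = 0"
      by (simp add: matrix_vector_mult_basis column_def vec_eq_iff)
    then show ?thesis
      using \<open>mat_of X $ i $ i = 0\<close> by (simp add: Yij ui mat_of_sym[of X i k])
  qed
  ultimately obtain f where f: "Y = (\<Sum>i\<in>I. outer (f i))"
    using insert.IH by blast
  have "X = (\<Sum>i\<in>insert k I. outer ((f(k := (1 / sqrt c) *\<^sub>R u)) i))"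
  proof -
    have "(\<Sum>i\<in>I. outer ((f(k := (1 / sqrt c) *\<^sub>R u)) i)) = Y"
      unfolding f using insert.hyps(2) by (intro sum.cong) auto
    then show ?thesis
      using insert.hyps by (simp add: Y_def)
  qed
  then show ?case by blast
qed

lemma psd_sum_outer:
  fixes X :: "'n::finite symmat"
  assumes "psd X"
  shows "\<exists>f :: 'n \<Rightarrow> real^'n. X = (\<Sum>i\<in>UNIV. outer (f i))"
  using psd_sum_outer_aux[of UNIV X] assms by auto

lemma psd_inner_nonneg:
  fixes S X :: "'n::finite symmat"
  assumes "psd S" "psd X"
  shows "0 \<le> S \<bullet> X"
proof -
  obtain f :: "'n \<Rightarrow> real^'n" where "X = (\<Sum>i\<in>UNIV. outer (f i))"
    using psd_sum_outer[OF assms(2)] by blast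
  then show ?thesis
    using assms(1) by (simp add: inner_sum_right psd_iff_outer sum_nonneg)
qed

lemma psd_inner_eq_0:
  fixes S X :: "'n::finite symmat"
  assumes "psd S" "psd X" "S \<bullet> X = 0"
  shows "mat_of S ** mat_of X = 0"
proof -
  obtain f :: "'n \<Rightarrow> real^'n" where f: "X = (\<Sum>i\<in>UNIV. outer (f i))"
    using psd_sum_outer[OF assms(2)] by blast
  have "\<forall>i\<in>UNIV. S \<bullet> outer (f i) = 0"
    using assms(1,3) unfolding f
    by (subst sum_nonneg_eq_0_iff[symmetric]) (auto simp: inner_sum_right psd_iff_outer)
  then have "mat_of S *v f i = 0" for i
    using psd_null_vector[OF assms(1)] by (simp add: inner_outer)
  then have "mat_of S *v (mat_of X *v v) = 0" for v
    by (simp add: f mat_of_sum_mult outer_mult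
        linear_sum[OF matrix_vector_mul_linear] matrix_vector_mult_scaleR)
  then show ?thesis
    by (simp add: matrix_eq flip: matrix_vector_mul_assoc)
qed

lemma pos_def_inner_psd_le_0:
  fixes X D :: "'n::finite symmat"
  assumes "pos_def X" "psd D" "D \<bullet> X \<le> 0"
  shows "D = 0"
proof -
  obtain f :: "'n \<Rightarrow> real^'n" where f: "D = (\<Sum>i\<in>UNIV. outer (f i))"
    using psd_sum_outer[OF assms(2)] by blast
  have *: "0 \<le> X \<bullet> outer (f i)" for i
    using pos_def_imp_psd[OF assms(1)] by (simp add: psd_iff_outer)
  have "D \<bullet> X = (\<Sum>i\<in>UNIV. X \<bullet> outer (f i))"
    unfolding f inner_sum_left by (simp add: inner_commute)
  then have "(\<Sum>i\<in>UNIV. X \<bullet> outer (f i)) = 0"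
    using assms(3) sum_nonneg[of UNIV "\<lambda>i. X \<bullet> outer (f i)"] * by simp
  then have "X \<bullet> outer (f i) = 0" for i
    using * by (simp add: sum_nonneg_eq_0_iff)
  then have "f i = 0" for i
    using assms(1) unfolding pos_def_def inner_outer by (metis less_irrefl)
  then show ?thesis
    by (simp add: f)
qed

section \<open>The projection onto the kernel\<close>

lemma matrix_add_rdistrib: "(P + Q) ** R = P ** R + Q ** R" for P Q :: "real^'k^'n"
  by (simp add: matrix_matrix_mult_def vec_eq_iff sum.distrib algebra_simps)

text \<open>
  \<open>kernel_split X Y E\<close> says that \<open>E\<close> is the orthogonal projection onto the kernel of \<open>X\<close> and that
  \<open>Y\<close> inverts \<open>X\<close> on the orthogonal complement of this kernel (the part of \<open>Y\<close> on the kernel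
  being immaterial).
\<close>

definition kernel_split :: "'n::finite symmat \<Rightarrow> 'n symmat \<Rightarrow> 'n symmat \<Rightarrow> bool" where
  "kernel_split X Y E \<longleftrightarrow>
     mat_of X ** mat_of E = 0 \<and> mat_of X ** mat_of Y + mat_of E = mat 1"

lemma kernel_splitD:
  assumes "kernel_split X Y E"
  shows "mat_of X ** mat_of E = 0" "mat_of E ** mat_of X = 0"
    "mat_of X ** mat_of Y + mat_of E = mat 1" "mat_of Y ** mat_of X + mat_of E = mat 1"
proof -
  show *: "mat_of X ** mat_of E = 0" "mat_of X ** mat_of Y + mat_of E = mat 1"
    using assms by (auto simp: kernel_split_def)
  have tr_add: "transpose (P + Q) = transpose P + transpose Q" for P Q :: "real^'a^'a"
    by (simp add: transpose_def vec_eq_iff)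
  have tr_0: "transpose (0 :: real^'a^'a) = 0"
    by (simp add: transpose_def vec_eq_iff)
  from arg_cong[OF *(1), of transpose] arg_cong[OF *(2), of transpose]
  show "mat_of E ** mat_of X = 0" "mat_of Y ** mat_of X + mat_of E = mat 1"
    by (simp_all add: matrix_transpose_mul tr_add tr_0)
qed

lemma kernel_split_exists: "\<exists>Y E. kernel_split X Y E"
proof -
  define N where "N = {v. mat_of X *v v = 0}"
  have "subspace N"
    by (auto simp: N_def subspace_def matrix_vector_right_distrib matrix_vector_mult_scaleR)
  then obtain B where B: "B \<subseteq> N" "pairwise orthogonal B" "\<And>x. x \<in> B \<Longrightarrow> norm x = 1"
    "independent B" "span B = N"
    by (metis orthonormal_basis_subspace)
  have finB: "finite B"
    using B(4) by (rule independent_imp_finite)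
  define E where "E = (\<Sum>b\<in>B. outer b)"
  have Ev: "mat_of E *v v = (\<Sum>b\<in>B. (b \<bullet> v) *\<^sub>R b)" for v
    by (simp add: E_def mat_of_sum_mult outer_mult)
  have EN: "mat_of E *v v \<in> N" for v
    unfolding Ev using B(1) \<open>subspace N\<close> by (auto intro!: subspace_sum subspace_scale)
  then have XE: "mat_of X ** mat_of E = 0"
    by (simp add: matrix_eq N_def flip: matrix_vector_mul_assoc)
  have EB: "mat_of E *v b = b" if "b \<in> B" for b
  proof -
    have "(\<Sum>b'\<in>B. (b' \<bullet> b) *\<^sub>R b') = (\<Sum>b'\<in>B. if b' = b then b else 0)"
    proof (rule sum.cong)
      fix b' assume "b' \<in> B"
      then show "(b' \<bullet> b) *\<^sub>R b' = (if b' = b then b else 0)"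
        using B(2) B(3)[OF that] that
        by (auto simp: pairwise_def orthogonal_def norm_eq_1)
    qed simp
    then show ?thesis
      using that finB by (simp add: Ev)
  qed
  have E_id: "mat_of E *v v = v" if "v \<in> N" for v
  proof (rule linear_eq_on_span[of "(*v) (mat_of E)" "\<lambda>v. v" B])
    show "v \<in> span B" using that B(5) by simp
  qed (use EB linear_id[unfolded id_def] in auto)
  \<comment> \<open>\<open>X + E\<close> is invertible, and its inverse serves as \<open>Y\<close>.\<close>
  define W where "W = mat_of X + mat_of E"
  have "inj ((*v) W)"
    unfolding matrix_left_invertible_injective[symmetric] matrix_left_invertible_ker
  proof (intro allI impI)
    fix v assume "W *v v = 0"
    then have *: "mat_of X *v v + mat_of E *v v = 0"
      by (simp add: W_def matrix_vector_mult_add_rdistrib)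
    have "(mat_of E *v v) \<bullet> (mat_of X *v v) = 0"
      using EN[of v] inner_mat_of_swap[of "mat_of E *v v" X v] by (simp add: N_def)
    then have "(mat_of E *v v) \<bullet> (mat_of E *v v) = 0"
      using * by (metis add.right_neutral add_0 inner_add_right inner_zero_right)
    then have "mat_of E *v v = 0" "mat_of X *v v = 0"
      using * by auto
    then show "v = 0"
      using E_id[of v] by (simp add: N_def)
  qed
  then obtain V where V: "V ** W = mat 1" "W ** V = mat 1"
    by (metis matrix_left_invertible_injective matrix_left_right_inverse)
  have Wsym: "transpose W = W"
    unfolding W_def using transpose_mat_of[of "X + E"] by (simp add: plus_symmat.rep_eq)
  have "transpose V ** W = mat 1"
    using arg_cong[OF V(2), of transpose] by (simp add: matrix_transpose_mul Wsym)
  then have "transpose V ** (W ** V) = V"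
    by (simp add: matrix_mul_assoc)
  then have "transpose V = V"
    by (simp add: V(2))
  then have Y: "mat_of (symmat_of V) = V"
    by (simp add: symmat_of_inverse)
  have EE: "mat_of E ** mat_of E = mat_of E"
    using E_id EN by (simp add: matrix_eq flip: matrix_vector_mul_assoc)
  have "mat_of E ** mat_of X = 0"
  proof -
    have "transpose (mat_of X ** mat_of E) = 0"
      by (simp add: XE transpose_def vec_eq_iff)
    then show ?thesis
      by (simp add: matrix_transpose_mul)
  qed
  then have "mat_of E ** W = mat_of E"
    using EE by (simp add: W_def matrix_add_ldistrib)
  then have "mat_of E ** V = mat_of E ** (W ** V)"
    by (simp add: matrix_mul_assoc)
  then have "mat_of E ** V = mat_of E"
    by (simp add: V(2))
  then have "mat_of X ** mat_of (symmat_of V) + mat_of E = mat 1"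
    using V(2) by (simp add: W_def Y matrix_add_rdistrib)
  with XE show ?thesis
    by (auto simp: kernel_split_def)
qed

lemma kernel_split_psd:
  assumes "kernel_split X Y E"
  shows "psd E"
  unfolding psd_def
proof
  fix v
  note split = kernel_splitD[OF assms]
  have "mat_of E = mat_of E ** (mat_of X ** mat_of Y + mat_of E)"
    by (simp add: split(3))
  also have "\<dots> = mat_of E ** mat_of E"
    by (simp add: matrix_add_ldistrib matrix_mul_assoc split(2))
  finally have "v \<bullet> (mat_of E *v v) = v \<bullet> (mat_of E *v (mat_of E *v v))"
    by (simp add: matrix_vector_mul_assoc)
  also have "\<dots> = (mat_of E *v v) \<bullet> (mat_of E *v v)"
    by (rule inner_mat_of_swap)
  finally show "0 \<le> v \<bullet> (mat_of E *v v)"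
    by simp
qed

text \<open>
  A complementary \<open>S\<close> that is positive definite on the kernel of \<open>X\<close> is strictly complementary:
  the ranges of \<open>X\<close> and \<open>S\<close> are orthogonal, and they span the space because \<open>X + S\<close> is invertible.
\<close>

lemma kernel_split_rank:
  fixes X S :: "'n::finite symmat"
  assumes split: "kernel_split X Y E" and X: "psd X" and SX: "mat_of S ** mat_of X = 0"
    and SE: "psd (S - d *\<^sub>R E)" "d > 0"
  shows "rank (mat_of X) + rank (mat_of S) = CARD('n)"
proof -
  let ?W = "mat_of X + mat_of S"
  have quad: "v \<bullet> (mat_of S *v v) = v \<bullet> (mat_of (S - d *\<^sub>R E) *v v) + d * (v \<bullet> (mat_of E *v v))" for v
    by (simp add: inner_diff_left flip: inner_outer)
  have pos: "0 \<le> v \<bullet> (mat_of E *v v)" "0 \<le> v \<bullet> (mat_of (S - d *\<^sub>R E) *v v)"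
    "0 \<le> v \<bullet> (mat_of X *v v)" for v
    using kernel_split_psd[OF split] SE X by (auto simp: psd_def)
  have "inj ((*v) ?W)"
    unfolding matrix_left_invertible_injective[symmetric] matrix_left_invertible_ker
  proof (intro allI impI)
    fix v assume "?W *v v = 0"
    then have "v \<bullet> (mat_of X *v v) + v \<bullet> (mat_of S *v v) = 0"
      by (metis inner_add_right inner_zero_right matrix_vector_mult_add_rdistrib)
    then have "v \<bullet> (mat_of X *v v) = 0" "d * (v \<bullet> (mat_of E *v v)) = 0"
      using quad[of v] pos[of v] SE(2) mult_nonneg_nonneg[of d "v \<bullet> (mat_of E *v v)"] by linarith+
    then have "mat_of X *v v = 0" "mat_of E *v v = 0"
      using psd_null_vector X kernel_split_psd[OF split] SE(2) by auto
    then have "(mat_of Y ** mat_of X + mat_of E) *v v = 0"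
      by (simp add: matrix_vector_mult_add_rdistrib flip: matrix_vector_mul_assoc)
    then show "v = 0"
      by (simp add: kernel_splitD(4)[OF split])
  qed
  then have surj: "surj ((*v) ?W)"
    using full_rank_injective full_rank_surjective by metis
  let ?RX = "range ((*v) (mat_of X))" and ?RS = "range ((*v) (mat_of S))"
  have "span (?RX \<union> ?RS) = UNIV"
  proof (intro equalityI subsetI)
    fix u :: "real^'n"
    obtain v where "u = ?W *v v"
      using surj by (metis surjD)
    then have "u = mat_of X *v v + mat_of S *v v"
      by (simp add: matrix_vector_mult_add_rdistrib)
    then show "u \<in> span (?RX \<union> ?RS)"
      using span_add[OF span_base span_base, of "mat_of X *v v" "?RX \<union> ?RS" "mat_of S *v v"] by blast
  qed simp
  then have "dim (?RX \<union> ?RS) = CARD('n)"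
    by (metis DIM_cart DIM_real dim_UNIV dim_span mult.right_neutral)
  moreover have "dim (?RX \<union> ?RS) = dim ?RX + dim ?RS"
  proof (rule dim_orthogonal_sum)
    fix x y assume "x \<in> ?RX" "y \<in> ?RS"
    then obtain u v where uv: "x = mat_of X *v u" "y = mat_of S *v v"
      by auto
    have "x \<bullet> y = v \<bullet> (mat_of S *v (mat_of X *v u))"
      unfolding uv by (rule inner_mat_of_swap)
    also have "\<dots> = 0"
      by (simp add: matrix_vector_mul_assoc SX)
    finally show "x \<bullet> y = 0" .
  qed
  ultimately show ?thesis
    by (simp add: rank_dim_range)
qed

lemma bounded_bilinear_matrix_mult:
  "bounded_bilinear ((**) :: real^'k^'n \<Rightarrow> real^'m^'k \<Rightarrow> real^'m^'n)"
  unfolding bilinear_conv_bounded_bilinear[symmetric] bilinear_def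
  by (intro conjI allI linearI)
    (simp_all only: matrix_add_ldistrib matrix_add_rdistrib matrix_scalar_ac scalar_matrix_assoc)

text \<open>
  As long as \<open>E\<close> and \<open>Y\<close> stay bounded, the projection onto the kernel is a Lipschitz function
  of the matrix. This follows from the identity \<open>E - E' = E (X' - X) Y' + Y (X' - X) E'\<close>.
\<close>

lemma kernel_split_Lipschitz:
  fixes r :: real
  shows "\<exists>L. \<forall>(X :: 'n::finite symmat) X' Y Y' E E'.
      kernel_split X Y E \<and> kernel_split X' Y' E' \<and>
      norm Y \<le> r \<and> norm Y' \<le> r \<and> norm E \<le> r \<and> norm E' \<le> r \<longrightarrow>
      norm (E - E') \<le> L * norm (X - X')"
proof -
  obtain K where K: "K > 0" "\<And>(P :: real^'n^'n) (Q :: real^'n^'n). norm (P ** Q) \<le> norm P * norm Q * K"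
    using bounded_bilinear.pos_bounded[OF bounded_bilinear_matrix_mult] by blast
  have K3: "norm (P ** Q ** R) \<le> r * norm Q * r * K\<^sup>2" if "norm P \<le> r" "norm R \<le> r" for P Q R :: "real^'n^'n"
  proof -
    have "norm (P ** Q ** R) \<le> norm (P ** Q) * norm R * K" using K(2)[of "P ** Q" R] .
    also have "\<dots> \<le> (norm P * norm Q * K) * norm R * K"
      using K by (intro mult_right_mono) auto
    also have "\<dots> = norm P * norm R * (norm Q * K\<^sup>2)" by (simp add: power2_eq_square)
    also have "\<dots> \<le> r * r * (norm Q * K\<^sup>2)"
      using that norm_ge_zero[of P] order_trans[OF norm_ge_zero that(1)] K(1)
      by (intro mult_right_mono mult_mono) auto
    finally show ?thesis by (simp add: mult_ac)
  qed
  show ?thesis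
  proof (intro exI allI impI)
    fix X X' Y Y' E E' :: "'n symmat"
    assume *: "kernel_split X Y E \<and> kernel_split X' Y' E' \<and>
      norm Y \<le> r \<and> norm Y' \<le> r \<and> norm E \<le> r \<and> norm E' \<le> r"
    note s = kernel_splitD[of X Y E] and s' = kernel_splitD[of X' Y' E']
    have sub: "P ** (Q - R) = P ** Q - P ** R" "(Q - R) ** P = Q ** P - R ** P" for P Q R :: "real^'n^'n"
      by (simp_all add: matrix_matrix_mult_def vec_eq_iff sum_subtractf algebra_simps)
    have "mat_of E = mat_of E ** mat_of X' ** mat_of Y' + mat_of E ** mat_of E'"
      using arg_cong[OF s'(3), of "(**) (mat_of E)"] *
      by (simp add: matrix_add_ldistrib matrix_mul_assoc)
    moreover have "mat_of E' = mat_of Y ** mat_of X ** mat_of E' + mat_of E ** mat_of E'"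
      using arg_cong[OF s(4), of "\<lambda>P. P ** mat_of E'"] *
      by (simp add: matrix_add_rdistrib)
    ultimately have "mat_of (E - E') = mat_of E ** mat_of X' ** mat_of Y' - mat_of Y ** mat_of X ** mat_of E'"
      unfolding mat_of_diff by (metis add_diff_cancel_right)
    also have "\<dots> = mat_of E ** mat_of (X' - X) ** mat_of Y' + mat_of Y ** mat_of (X' - X) ** mat_of E'"
      using s(2) s'(1) * by (simp add: mat_of_diff sub matrix_mul_assoc[symmetric])
    also have "norm \<dots> \<le> r * norm (X' - X) * r * K\<^sup>2 + r * norm (X' - X) * r * K\<^sup>2"
      using * by (intro norm_triangle_le add_mono K3[of _ _ "mat_of (X' - X)", unfolded norm_mat_of] K3) (auto simp: norm_mat_of)
    finally show "norm (E - E') \<le> (2 * r * r * K\<^sup>2) * norm (X - X')"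
      by (simp add: norm_mat_of norm_minus_commute mult_ac)
  qed
qed

lemma closed_kernel_split:
  "closed {(X, Y, E). kernel_split X Y E}"
proof -
  have cont: "continuous_on UNIV (\<lambda>p. mat_of (f p))" if "continuous_on UNIV f" for f :: "'b::topological_space \<Rightarrow> 'a symmat"
    using linear_continuous_on[OF linear_mat_of[unfolded linear_conv_bounded_linear]] that
    by (metis continuous_on_compose2 subset_UNIV)
  have "{(X :: 'a symmat, Y, E). kernel_split X Y E} =
     {p. mat_of (fst p) ** mat_of (snd (snd p)) = 0} \<inter>
     {p. mat_of (fst p) ** mat_of (fst (snd p)) + mat_of (snd (snd p)) = mat 1}"
    by (auto simp: kernel_split_def)
  also have "closed \<dots>"
    by (intro closed_Int closed_Collect_eq continuous_on_add continuous_on_const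
        bounded_bilinear.continuous_on[OF bounded_bilinear_matrix_mult] cont continuous_intros)
  finally show ?thesis .
qed

section \<open>Optimality conditions\<close>

lemma slack_inner:
  fixes A :: "'n::finite symmat \<Rightarrow> real^'m"
  assumes "linear A" "A X = b"
  shows "(C - adjoint A y) \<bullet> X = C \<bullet> X - b \<bullet> y"
proof -
  have "adjoint A y \<bullet> X = b \<bullet> y"
    using adjoint_works[OF assms(1), of X y] assms(2) by (simp add: inner_commute)
  then show ?thesis
    by (simp add: inner_diff_left)
qed

lemma complementary_imp_solutions:
  fixes A :: "'n::finite symmat \<Rightarrow> real^'m"
  assumes A: "linear A" and X: "primal_feasible A b X"
    and S: "psd (C - adjoint A y)" "(C - adjoint A y) \<bullet> X = 0"
  shows "primal_solution A b C X" "dual_solution A b C y"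
proof -
  have gap: "(C - adjoint A y') \<bullet> X' = C \<bullet> X' - b \<bullet> y'" if "primal_feasible A b X'" for X' y'
    using slack_inner[OF A] that by (simp add: primal_feasible_def)
  show "primal_solution A b C X"
    unfolding primal_solution_def
  proof (intro conjI allI impI X)
    fix X' assume X': "primal_feasible A b X'"
    then have "0 \<le> (C - adjoint A y) \<bullet> X'"
      using psd_inner_nonneg[OF S(1)] by (simp add: primal_feasible_def)
    then show "C \<bullet> X \<le> C \<bullet> X'"
      using gap[OF X', of y] gap[OF X, of y] S(2) by simp
  qed
  show "dual_solution A b C y"
    unfolding dual_solution_def dual_feasible_def
  proof (intro conjI allI impI S(1))
    fix y' assume "psd (C - adjoint A y')"
    then have "0 \<le> (C - adjoint A y') \<bullet> X"
      using psd_inner_nonneg X by (auto simp: primal_feasible_def)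
    then show "b \<bullet> y' \<le> b \<bullet> y"
      using gap[OF X, of y'] gap[OF X, of y] S(2) by simp
  qed
qed

lemma psd_if_inner_bounded_below:
  assumes "\<And>X. psd X \<Longrightarrow> \<beta> \<le> D \<bullet> X"
  shows "psd D"
  unfolding psd_iff_outer
proof (rule allI, rule ccontr)
  fix v assume "\<not> 0 \<le> D \<bullet> outer v"
  then have neg: "D \<bullet> outer v < 0" by simp
  \<comment> \<open>Chosen so that \<open>c v v\<^sup>T\<close> attains the value \<open>- (\<bar>\<beta>\<bar> + 1)\<close>, which is below \<open>\<beta>\<close>.\<close>
  define c where "c = (\<bar>\<beta>\<bar> + 1) / - (D \<bullet> outer v)"
  have "0 \<le> c" using neg by (simp add: c_def divide_simps)
  then have "\<beta> \<le> c * (D \<bullet> outer v)"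
    using assms[OF psd_scaleR[OF psd_outer, of c v]] by simp
  also have "\<dots> = - (\<bar>\<beta>\<bar> + 1)"
    using neg by (simp add: c_def)
  finally show False by linarith
qed

text \<open>
  Strong duality with dual attainment: the images \<open>(\<A> X' - b, \<langle>C, X'\<rangle> - \<langle>C, X\<rangle> + s)\<close> of positive
  semidefinite \<open>X'\<close> and \<open>s > 0\<close> form a convex set that avoids the origin. If a separating
  functional is scaled to have coefficient 1 on the objective, its coefficients on the constraints
  are the negative of a dual solution.
\<close>

lemma complementary_dual_exists:
  fixes A :: "'n::finite symmat \<Rightarrow> real^'m"
  assumes A: "linear A" "surj A" and slater: "pos_def X\<^sub>0" "A X\<^sub>0 = b"
    and sol: "primal_solution A b C X"
  shows "\<exists>y. psd (C - adjoint A y) \<and> (C - adjoint A y) \<bullet> X = 0"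
proof -
  have X: "A X = b" "psd X" and opt: "\<And>X'. A X' = b \<Longrightarrow> psd X' \<Longrightarrow> C \<bullet> X \<le> C \<bullet> X'"
    using sol by (auto simp: primal_solution_def primal_feasible_def)
  define Q where "Q = {(A X' - b, C \<bullet> X' - C \<bullet> X + s) | X' s. psd X' \<and> 0 < s}"
  have "convex Q"
    unfolding convex_def
  proof (intro ballI allI impI)
    fix p q :: "(real^'m) \<times> real" and u v :: real
    assume pq: "p \<in> Q" "q \<in> Q" and uv: "0 \<le> u" "0 \<le> v" "u + v = 1"
    obtain P s where P: "p = (A P - b, C \<bullet> P - C \<bullet> X + s)" "psd P" "0 < s"
      using pq(1) by (auto simp: Q_def)
    obtain Z t where Z: "q = (A Z - b, C \<bullet> Z - C \<bullet> X + t)" "psd Z" "0 < t"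
      using pq(2) by (auto simp: Q_def)
    have "u *\<^sub>R b + v *\<^sub>R b = b" "u * (C \<bullet> X) + v * (C \<bullet> X) = C \<bullet> X"
      using uv(3) by (metis scaleR_left.add scaleR_one, metis distrib_right mult_1)
    then have "u *\<^sub>R p + v *\<^sub>R q =
        (A (u *\<^sub>R P + v *\<^sub>R Z) - b, C \<bullet> (u *\<^sub>R P + v *\<^sub>R Z) - C \<bullet> X + (u * s + v * t))"
      using A(1) by (simp add: P(1) Z(1) linear_add linear_scale inner_add_right algebra_simps)
    moreover have "psd (u *\<^sub>R P + v *\<^sub>R Z)"
      using P Z uv by (intro psd_add psd_scaleR)
    moreover have "0 < u * s + v * t"
      using P(3) Z(3) uv by (cases "u = 0") (auto intro: add_pos_nonneg)
    ultimately show "u *\<^sub>R p + v *\<^sub>R q \<in> Q"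
      unfolding Q_def by blast
  qed
  moreover have "0 \<notin> Q"
    using opt by (fastforce simp: Q_def zero_prod_def)
  ultimately obtain l \<mu> where lm: "(l, \<mu>) \<noteq> 0" and sep0: "\<And>p. p \<in> Q \<Longrightarrow> 0 \<le> (l, \<mu>) \<bullet> p"
    using separating_hyperplane_set_0[of Q] by (metis prod.exhaust)
  have sep: "0 \<le> l \<bullet> (A X' - b) + \<mu> * (C \<bullet> X' - C \<bullet> X + s)" if "psd X'" "0 < s" for X' s
    using sep0[of "(A X' - b, C \<bullet> X' - C \<bullet> X + s)"] that by (auto simp: Q_def)
  have "0 \<le> \<mu>"
    using sep[of X 1] X by simp
  \<comment> \<open>Slater's condition excludes a separating functional that ignores the objective.\<close>
  moreover have "\<mu> \<noteq> 0"
  proof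
    assume "\<mu> = 0"
    have low: "l \<bullet> b \<le> adjoint A l \<bullet> X'" if "psd X'" for X'
      using sep[OF that, of 1] \<open>\<mu> = 0\<close> adjoint_works[OF A(1), of X' l]
      by (simp add: inner_diff_right inner_commute)
    have "l \<bullet> b \<le> 0"
      using low[of 0] by simp
    then have "adjoint A l \<bullet> X\<^sub>0 \<le> 0"
      using adjoint_works[OF A(1), of X\<^sub>0 l] slater(2) by (simp add: inner_commute)
    then have "adjoint A l = 0"
      using pos_def_inner_psd_le_0[OF slater(1) psd_if_inner_bounded_below[OF low]] by simp
    then have "A X' \<bullet> l = 0" for X'
      using adjoint_works[OF A(1), of X' l] by simp
    then have "l \<bullet> l = 0"
      using A(2) by (metis surjD)
    with lm \<open>\<mu> = 0\<close> show False
      by (simp add: zero_prod_def)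
  qed
  ultimately have \<mu>: "0 < \<mu>" by simp
  define y where "y = - (1 / \<mu>) *\<^sub>R l"
  define S where "S = C - adjoint A y"
  have low: "C \<bullet> X - b \<bullet> y \<le> S \<bullet> X'" if "psd X'" for X'
  proof (rule field_le_epsilon)
    fix e :: real assume "0 < e"
    have "0 \<le> (l \<bullet> (A X' - b) + \<mu> * (C \<bullet> X' - C \<bullet> X + e)) / \<mu>"
      using sep[OF that \<open>0 < e\<close>] \<mu> by simp
    also have "\<dots> = (C \<bullet> X' - A X' \<bullet> y) - (C \<bullet> X - b \<bullet> y) + e"
      using \<mu> by (simp add: y_def inner_diff_right inner_commute field_simps)
    finally show "C \<bullet> X - b \<bullet> y \<le> S \<bullet> X' + e"
      using slack_inner[OF A(1) refl, of C y X'] by (simp add: S_def)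
  qed
  have "psd S"
    using low by (rule psd_if_inner_bounded_below)
  moreover have "S \<bullet> X \<le> 0"
    using low[of 0] slack_inner[OF A(1) X(1), of C y] by (simp add: S_def)
  ultimately show ?thesis
    using psd_inner_nonneg[of S X] X(2) by (auto simp: S_def intro!: exI[of _ y])
qed

lemma primal_simpleI:
  fixes A :: "'n::finite symmat \<Rightarrow> real^'m"
  assumes A: "linear A" "surj A" and X: "primal_solution A b C X"
    and unique: "\<And>X'. primal_solution A b C X' \<Longrightarrow> X' = X"
    and S: "psd (C - adjoint A y)" "(C - adjoint A y) \<bullet> X = 0"
    and rank: "rank (mat_of X) + rank (mat_of (C - adjoint A y)) = CARD('n)"
  shows "primal_simple A b C"
proof -
  have feas: "primal_feasible A b X"
    using X by (simp add: primal_solution_def)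
  then have dual: "dual_solution A b C y"
    using complementary_imp_solutions(2)[OF A(1) _ S] by simp
  have "trace (mat_of C ** mat_of X') = b \<bullet> y'"
    if "primal_solution A b C X'" "dual_solution A b C y'" for X' y'
  proof -
    have "b \<bullet> y' = b \<bullet> y"
      using that(2) dual unfolding dual_solution_def by (meson order_antisym)
    then show ?thesis
      using unique[OF that(1)] slack_inner[OF A(1), of X b C y] feas S(2)
      by (simp add: primal_feasible_def flip: inner_eq_trace)
  qed
  then show ?thesis
    using A(2) X unique dual rank
    unfolding primal_simple_def strong_duality_def strict_complementarity_def by blast
qed

section \<open>Exceptional objectives\<close>

lemma primal_solution_monotone:
  assumes "primal_solution A b C X" "primal_solution A b C' X'"
  shows "(X - X') \<bullet> (C - C') \<le> 0"
proof -
  have "C \<bullet> X \<le> C \<bullet> X'" "C' \<bullet> X' \<le> C' \<bullet> X"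
    using assms by (auto simp: primal_solution_def)
  then show ?thesis
    by (simp add: inner_diff_left inner_diff_right inner_commute)
qed

lemma continuous_on_linear:
  fixes g :: "'a::euclidean_space \<Rightarrow> 'b::real_normed_vector"
  assumes "linear g" "continuous_on S f"
  shows "continuous_on S (\<lambda>p. g (f p))"
  by (rule continuous_on_compose2[OF linear_continuous_on assms(2)])
    (use assms(1) in \<open>auto simp: linear_conv_bounded_linear\<close>)

lemma closed_primal_solution:
  assumes "linear A"
  shows "closed {(X, C). primal_solution A b C X}"
proof -
  have contA: "continuous_on UNIV (\<lambda>p. A (fst p))"
    by (intro continuous_on_linear[OF assms] continuous_intros)
  have "{(X, C). primal_solution A b C X} =
      {p. A (fst p) = b} \<inter> fst -` {X. psd X} \<inter>
      (\<Inter>X'\<in>{X'. primal_feasible A b X'}. {p. snd p \<bullet> fst p \<le> snd p \<bullet> X'})"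
    by (auto simp: primal_solution_def primal_feasible_def)
  also have "closed \<dots>"
    by (intro closed_Int closed_INT ballI closed_Collect_eq closed_Collect_le closed_vimage_fst
        closed_psd contA continuous_intros)
  finally show ?thesis .
qed

lemma negligible_nonunique:
  fixes A :: "'n::finite symmat \<Rightarrow> real^'m"
  assumes A: "linear A"
  shows "negligible {C. \<exists>X X'. primal_solution A b C X \<and> primal_solution A b C X' \<and> X \<noteq> X'}"
proof -
  \<comment> \<open>The bound \<open>k\<close> makes each of these sets compact.\<close>
  define D where "D = (\<lambda>(e, q :: rat, q' :: rat, k :: nat).
     {C. \<exists>X X'. primal_solution A b C X \<and> primal_solution A b C X' \<and>
       norm X \<le> k \<and> norm X' \<le> k \<and> norm C \<le> k \<and> X \<bullet> e \<le> of_rat q \<and> of_rat q' \<le> X' \<bullet> e})"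
  let ?I = "(Basis :: 'n symmat set) \<times> {(q, q', k). q < q'}"
  have "negligible (D i)" if "i \<in> ?I" for i
  proof -
    obtain e q q' k where i: "i = (e, q, q', k)" and "q < q'"
      using \<open>i \<in> ?I\<close> by auto
    show ?thesis
    proof (rule negligible_disjoint_translates[where e = e])
      define G where "G = {(X, C). primal_solution A b C X}"
      define f :: "'n symmat \<times> 'n symmat \<times> 'n symmat \<Rightarrow> 'n symmat \<times> 'n symmat"
        where "f = (\<lambda>p. (fst p, snd (snd p)))"
      define f' :: "'n symmat \<times> 'n symmat \<times> 'n symmat \<Rightarrow> 'n symmat \<times> 'n symmat"
        where "f' = (\<lambda>p. (fst (snd p), snd (snd p)))"
      define T where "T = (cball 0 k \<times> cball 0 k \<times> cball 0 k) \<inter> (f -` G \<inter> f' -` G \<inter>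
          {p. fst p \<bullet> e \<le> of_rat q} \<inter> {p. of_rat q' \<le> fst (snd p) \<bullet> e})"
      have "closed G"
        unfolding G_def by (rule closed_primal_solution[OF A])
      then have "closed (f -` G)" "closed (f' -` G)"
        unfolding f_def f'_def by (auto intro!: closed_vimage continuous_intros)
      then have "compact T"
        unfolding T_def
        by (intro compact_Int_closed compact_Times compact_cball closed_Int closed_Collect_le)
          (auto intro!: continuous_intros)
      moreover have "D i = (\<lambda>p. snd (snd p)) ` T"
        by (force simp: D_def i T_def f_def f'_def G_def image_iff)
      ultimately show "compact (D i)"
        by (auto intro!: compact_continuous_image continuous_intros)
    next
      fix C and t :: real
      assume C: "C \<in> D i" and "t > 0"
      show "C + t *\<^sub>R e \<notin> D i"
      proof
        assume "C + t *\<^sub>R e \<in> D i"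
        then obtain X' where X': "primal_solution A b (C + t *\<^sub>R e) X'" "of_rat q' \<le> X' \<bullet> e"
          by (auto simp: D_def i)
        obtain X where X: "primal_solution A b C X" "X \<bullet> e \<le> of_rat q"
          using C by (auto simp: D_def i)
        have "t * ((X' - X) \<bullet> e) \<le> 0"
          using primal_solution_monotone[OF X'(1) X(1)] by simp
        then have "X' \<bullet> e \<le> X \<bullet> e"
          using \<open>t > 0\<close> by (simp add: mult_le_0_iff inner_diff_left)
        then have "(of_rat q' :: real) \<le> of_rat q"
          using X(2) X'(2) by linarith
        with \<open>q < q'\<close> show False
          by (simp add: of_rat_less_eq)
      qed
    qed
  qed
  moreover have "countable (D ` ?I)"
    by (intro countable_image countable_SIGMA countable_finite[OF finite_Basis] countableI_type)
  ultimately have "negligible (\<Union>(D ` ?I))"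
    by (intro negligible_countable_Union) auto
  moreover have "C \<in> \<Union>(D ` ?I)"
    if sol: "primal_solution A b C X" "primal_solution A b C X'" and "X \<noteq> X'" for C X X'
  proof -
    have *: "C \<in> \<Union>(D ` ?I)" if X: "primal_solution A b C X" "primal_solution A b C X'"
      and e: "e \<in> Basis" "X \<bullet> e < X' \<bullet> e" for X X' e
    proof -
      obtain q where q: "X \<bullet> e < of_rat q" "of_rat q < X' \<bullet> e"
        using of_rat_dense[OF e(2)] by blast
      obtain q' where q': "of_rat q < (of_rat q' :: real)" "of_rat q' < X' \<bullet> e"
        using of_rat_dense[OF q(2)] by blast
      obtain k :: nat where "max (norm X) (max (norm X') (norm C)) \<le> k"
        using real_arch_simple by blast
      then have "C \<in> D (e, q, q', k)"
        using X q q' unfolding D_def by simp (rule exI[of _ X], simp, rule exI[of _ X'], simp)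
      moreover have "(e, q, q', k) \<in> ?I"
        using e q' by (simp add: of_rat_less)
      ultimately show ?thesis by blast
    qed
    obtain e where e: "e \<in> Basis" "X \<bullet> e \<noteq> X' \<bullet> e"
      using \<open>X \<noteq> X'\<close> euclidean_eqI by blast
    show ?thesis
    proof (cases "X \<bullet> e < X' \<bullet> e")
      case True
      then show ?thesis using *[OF sol e(1)] by blast
    next
      case False
      then show ?thesis using *[OF sol(2,1) e(1)] e(2) by linarith
    qed
  qed
  ultimately show ?thesis
    by (auto intro: negligible_subset)
qed

text \<open>
  The bounds by \<open>r\<close> make the set of optimal pairs compact and the projection \<open>E\<close> Lipschitz in \<open>X\<close>.
  The condition on \<open>y\<close> and \<open>d\<close> says that the slack of \<open>y\<close> is complementary to \<open>X\<close> and positive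
  definite on the kernel of \<open>X\<close>.
\<close>

lemma negligible_not_strictly_complementary:
  fixes A :: "'n::finite symmat \<Rightarrow> real^'m" and r :: real
  assumes A: "linear A" "surj A" and slater: "pos_def X\<^sub>0" "A X\<^sub>0 = b"
  shows "negligible {C. \<exists>X Y E. primal_solution A b C X \<and> kernel_split X Y E \<and>
     norm X \<le> r \<and> norm C \<le> r \<and> norm E \<le> r \<and> norm Y \<le> r \<and>
     \<not> (\<exists>y d. d > 0 \<and> psd (C - adjoint A y - d *\<^sub>R E) \<and> (C - adjoint A y) \<bullet> X = 0)}"
proof -
  define K where "K = {(X, C, E). primal_solution A b C X \<and> norm X \<le> r \<and> norm C \<le> r \<and> norm E \<le> r \<and>
     (\<exists>Y. norm Y \<le> r \<and> kernel_split X Y E)}"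
  \<comment> \<open>The strictly complementary pairs, exhausted by compact sets.\<close>
  define J where "J j = {(X, C, E). (X, C, E) \<in> K \<and> (\<exists>y. norm y \<le> real j \<and>
     psd (C - adjoint A y - (1 / real (Suc j)) *\<^sub>R E) \<and> (C - adjoint A y) \<bullet> X = 0)}" for j
  define R where "R = K - (\<Union>j. J j)"
  have cont_adj: "continuous_on UNIV (\<lambda>p. adjoint A (f p))" if "continuous_on UNIV f"
    for f :: "'b::topological_space \<Rightarrow> real^'m"
    using adjoint_linear[OF A(1)] that by (rule continuous_on_linear)
  have KE: "psd E" "E \<bullet> X = 0" if "(X, C, E) \<in> K" for X C E
  proof -
    obtain Y where Y: "kernel_split X Y E"
      using \<open>(X, C, E) \<in> K\<close> by (auto simp: K_def)
    show "psd E" using kernel_split_psd[OF Y] .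
    show "E \<bullet> X = 0" by (simp add: inner_eq_trace kernel_splitD(2)[OF Y] trace_def)
  qed
  have J_iff: "(X, C, E) \<in> (\<Union>j. J j) \<longleftrightarrow>
      (\<exists>y d. d > 0 \<and> psd (C - adjoint A y - d *\<^sub>R E) \<and> (C - adjoint A y) \<bullet> X = 0)"
    if K: "(X, C, E) \<in> K" for X C E
  proof
    assume "(X, C, E) \<in> (\<Union>j. J j)"
    then obtain j y where "psd (C - adjoint A y - (1 / real (Suc j)) *\<^sub>R E)" "(C - adjoint A y) \<bullet> X = 0"
      by (auto simp: J_def)
    then show "\<exists>y d. d > 0 \<and> psd (C - adjoint A y - d *\<^sub>R E) \<and> (C - adjoint A y) \<bullet> X = 0"
      by (intro exI[of _ y] exI[of _ "1 / real (Suc j)"]) simp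
  next
    assume "\<exists>y d. d > 0 \<and> psd (C - adjoint A y - d *\<^sub>R E) \<and> (C - adjoint A y) \<bullet> X = 0"
    then obtain y d where y: "d > 0" "psd (C - adjoint A y - d *\<^sub>R E)" "(C - adjoint A y) \<bullet> X = 0"
      by blast
    obtain j :: nat where j: "max (norm y) (1 / d) \<le> j"
      using real_arch_simple by blast
    have "1 / d \<le> real (Suc j)"
      using j by simp
    then have "1 / real (Suc j) \<le> d"
      using y(1) by (simp add: field_simps)
    then have "psd ((C - adjoint A y - d *\<^sub>R E) + (d - 1 / real (Suc j)) *\<^sub>R E)"
      using y KE[OF K] by (intro psd_add psd_scaleR) auto
    then have "psd (C - adjoint A y - (1 / real (Suc j)) *\<^sub>R E)"
      by (simp add: algebra_simps)
    then have "(X, C, E) \<in> J j"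
      using K j y(3) by (auto simp: J_def)
    then show "(X, C, E) \<in> (\<Union>j. J j)"
      by blast
  qed
  \<comment> \<open>Moving \<open>C\<close> by \<open>s E\<close> keeps \<open>X\<close> optimal and adds \<open>s E\<close> to the slack.\<close>
  have shifted: "\<exists>y. psd (C + s *\<^sub>R E - adjoint A y - s *\<^sub>R E) \<and> (C + s *\<^sub>R E - adjoint A y) \<bullet> X = 0
      \<and> primal_solution A b (C + s *\<^sub>R E) X"
    if K: "(X, C, E) \<in> K" and "0 \<le> s" for X C E s
  proof -
    have X: "primal_solution A b C X"
      using K by (simp add: K_def)
    obtain y where y: "psd (C - adjoint A y)" "(C - adjoint A y) \<bullet> X = 0"
      using complementary_dual_exists[OF A slater X] by blast
    have eq: "C + s *\<^sub>R E - adjoint A y = (C - adjoint A y) + s *\<^sub>R E"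
      by simp
    have *: "psd (C + s *\<^sub>R E - adjoint A y)" "(C + s *\<^sub>R E - adjoint A y) \<bullet> X = 0"
      unfolding eq using y KE[OF K] \<open>0 \<le> s\<close>
      by (auto intro!: psd_add psd_scaleR simp: inner_add_left)
    have "primal_feasible A b X"
      using X by (simp add: primal_solution_def)
    then have "primal_solution A b (C + s *\<^sub>R E) X"
      using * by (rule complementary_imp_solutions(1)[OF A(1)])
    then show ?thesis
      using y * by (intro exI[of _ y]) simp
  qed
  obtain L where L: "\<And>(X :: 'n symmat) X' Y Y' E E'.
      kernel_split X Y E \<Longrightarrow> kernel_split X' Y' E' \<Longrightarrow>
      norm Y \<le> r \<Longrightarrow> norm Y' \<le> r \<Longrightarrow> norm E \<le> r \<Longrightarrow> norm E' \<le> r \<Longrightarrow>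
      norm (E - E') \<le> L * norm (X - X')"
    using kernel_split_Lipschitz[of r] by meson
  have "negligible ((\<lambda>(X, C, E). C) ` R)"
  proof (rule negligible_monotone_shift[OF _ _ _ R_def])
    show "compact K"
    proof -
      define f :: "'n symmat \<times> 'n symmat \<times> 'n symmat \<times> 'n symmat \<Rightarrow> 'n symmat \<times> 'n symmat"
        where "f = (\<lambda>p. (fst p, fst (snd p)))"
      define g :: "'n symmat \<times> 'n symmat \<times> 'n symmat \<times> 'n symmat \<Rightarrow> 'n symmat \<times> 'n symmat \<times> 'n symmat"
        where "g = (\<lambda>p. (fst p, snd (snd (snd p)), fst (snd (snd p))))"
      define T where "T = (cball 0 r \<times> cball 0 r \<times> cball 0 r \<times> cball 0 r) \<inter>
        (f -` {(X, C). primal_solution A b C X} \<inter> g -` {(X, Y, E). kernel_split X Y E})"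
      have "closed (f -` {(X, C). primal_solution A b C X})" "closed (g -` {(X, Y, E). kernel_split X Y E})"
        unfolding f_def g_def
        by (intro closed_vimage closed_primal_solution[OF A(1)] closed_kernel_split continuous_intros)+
      then have "compact T"
        unfolding T_def by (intro compact_Int_closed compact_Times compact_cball closed_Int)
      moreover have "K = (\<lambda>p. (fst p, fst (snd p), fst (snd (snd p)))) ` T"
        by (force simp: K_def T_def f_def g_def image_iff)
      ultimately show ?thesis
        by (auto intro!: compact_continuous_image continuous_intros)
    qed
    show "compact (J j)" for j
    proof -
      define T where "T = (K \<times> cball 0 (real j)) \<inter>
        ((\<lambda>p. fst (snd (fst p)) - adjoint A (snd p) - (1 / real (Suc j)) *\<^sub>R snd (snd (fst p))) -` {X. psd X} \<inter>
         {p. (fst (snd (fst p)) - adjoint A (snd p)) \<bullet> fst (fst p) = 0})"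
      have "compact T"
        unfolding T_def
        by (intro compact_Int_closed compact_Times compact_cball \<open>compact K\<close> closed_Int closed_Collect_eq
            closed_vimage closed_psd continuous_intros cont_adj)
      moreover have "J j = fst ` T"
        by (force simp: J_def T_def image_iff)
      ultimately show ?thesis
        by (auto intro!: compact_continuous_image continuous_intros)
    qed
    show "J j \<subseteq> K" for j
      by (auto simp: J_def)
  next
    fix X C E X' C' E' and s t :: real
    assume "(X, C, E) \<in> K" "(X', C', E') \<in> K" "0 \<le> s" "0 \<le> t"
    then show "(X - X') \<bullet> ((C + s *\<^sub>R E) - (C' + t *\<^sub>R E')) \<le> 0"
      using shifted primal_solution_monotone by meson
  next
    fix X C E X' C' E'
    assume "(X, C, E) \<in> K" "(X', C', E') \<in> K"
    then show "norm (E - E') \<le> L * norm (X - X')"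
      using L by (auto simp: K_def)
  next
    fix X C E and t :: real
    assume "(X, C, E) \<in> R" "0 < t"
    then obtain y where "psd (C + t *\<^sub>R E - adjoint A y - t *\<^sub>R E)" "(C + t *\<^sub>R E - adjoint A y) \<bullet> X = 0"
      using shifted[of X C E t] unfolding R_def by (meson DiffD1 less_imp_le)
    then have "\<exists>y d. d > 0 \<and> psd (C + t *\<^sub>R E - adjoint A y - d *\<^sub>R E) \<and> (C + t *\<^sub>R E - adjoint A y) \<bullet> X = 0"
      using \<open>0 < t\<close> by blast
    then show "(X, C + t *\<^sub>R E, E) \<notin> R"
      using J_iff[of X "C + t *\<^sub>R E" E] by (auto simp: R_def)
  qed
  then show ?thesis
  proof (rule negligible_subset, safe)
    fix C X Y E
    assume "primal_solution A b C X" "kernel_split X Y E"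
      "norm X \<le> r" "norm C \<le> r" "norm E \<le> r" "norm Y \<le> r"
      and no: "\<not> (\<exists>y d. d > 0 \<and> psd (C - adjoint A y - d *\<^sub>R E) \<and> (C - adjoint A y) \<bullet> X = 0)"
    then have K: "(X, C, E) \<in> K"
      by (auto simp: K_def)
    then have "(X, C, E) \<in> R"
      using J_iff[OF K] no by (auto simp: R_def)
    then show "C \<in> (\<lambda>(X, C, E). C) ` R"
      by force
  qed
qed

theorem theorem2:
  fixes A :: "'n::finite symmat \<Rightarrow> real^'m" and b :: "real^'m"
  assumes "linear A" and "surj A"
    and "\<exists>X\<^sub>0. pos_def X\<^sub>0 \<and> A X\<^sub>0 = b"
  shows "AE C in lebesgue. (\<exists>X. primal_solution A b C X) \<longrightarrow> primal_simple A b C"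
proof -
  obtain X\<^sub>0 where slater: "pos_def X\<^sub>0" "A X\<^sub>0 = b"
    using assms(3) by blast
  define N\<^sub>1 where "N\<^sub>1 = {C. \<exists>X X'. primal_solution A b C X \<and> primal_solution A b C X' \<and> X \<noteq> X'}"
  define N\<^sub>2 where "N\<^sub>2 r = {C. \<exists>X Y E. primal_solution A b C X \<and> kernel_split X Y E \<and>
     norm X \<le> r \<and> norm C \<le> r \<and> norm E \<le> r \<and> norm Y \<le> r \<and>
     \<not> (\<exists>y d. d > 0 \<and> psd (C - adjoint A y - d *\<^sub>R E) \<and> (C - adjoint A y) \<bullet> X = 0)}" for r :: real
  have "negligible N\<^sub>1"
    unfolding N\<^sub>1_def by (rule negligible_nonunique[OF assms(1)])
  moreover have "negligible (N\<^sub>2 r)" for r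
    unfolding N\<^sub>2_def by (rule negligible_not_strictly_complementary[OF assms(1,2) slater])
  then have "negligible (\<Union>k :: nat. N\<^sub>2 (real k))"
    by (intro negligible_countable_Union) auto
  ultimately have "negligible (N\<^sub>1 \<union> (\<Union>k :: nat. N\<^sub>2 (real k)))"
    by (rule negligible_Un)
  then have null: "N\<^sub>1 \<union> (\<Union>k :: nat. N\<^sub>2 (real k)) \<in> null_sets lebesgue"
    by (simp add: negligible_iff_null_sets)
  have "primal_simple A b C"
    if C: "C \<notin> N\<^sub>1 \<union> (\<Union>k :: nat. N\<^sub>2 (real k))" and X: "primal_solution A b C X" for C X
  proof -
    obtain Y E where split: "kernel_split X Y E"
      using kernel_split_exists by blast
    obtain k :: nat where "max (max (norm X) (norm C)) (max (norm E) (norm Y)) \<le> real k"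
      using real_arch_simple by blast
    moreover have "C \<notin> N\<^sub>2 (real k)"
      using C by blast
    ultimately have "\<exists>y d. d > 0 \<and> psd (C - adjoint A y - d *\<^sub>R E) \<and> (C - adjoint A y) \<bullet> X = 0"
      using X split unfolding N\<^sub>2_def max.bounded_iff by blast
    then obtain y d where y: "d > 0" "psd (C - adjoint A y - d *\<^sub>R E)" "(C - adjoint A y) \<bullet> X = 0"
      by blast
    have "psd ((C - adjoint A y - d *\<^sub>R E) + d *\<^sub>R E)"
      using y kernel_split_psd[OF split] by (intro psd_add psd_scaleR) auto
    then have S: "psd (C - adjoint A y)"
      by simp
    have "psd X"
      using X by (simp add: primal_solution_def primal_feasible_def)
    then have "rank (mat_of X) + rank (mat_of (C - adjoint A y)) = CARD('n)"
      using kernel_split_rank[OF split _ psd_inner_eq_0[OF S _ y(3)] y(2,1)] by simp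
    moreover have "X' = X" if "primal_solution A b C X'" for X'
      using C X that unfolding N\<^sub>1_def by blast
    ultimately show ?thesis
      using primal_simpleI[OF assms(1,2) X _ S y(3)] by blast
  qed
  then show ?thesis
    by (intro AE_I'[OF null]) auto
qed

end
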